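(* Let $p$ be a prime number and let $(a_n)_{n\in\mathbb{N}}\subset\mathbb{Z}_p$ be a sequence having a pseudo-polynomial decomposition modulo $p$ (on $\mathbb{N}$). Then there exist a continuous function $f_{p,\infty}:\mathbb{Z}_p\to\mathbb{Z}_p$, which is a uniform limit on $\mathbb{Z}_p$ (with respect to the $p$-adic norm) of polynomials with integer coefficients, and a function $g_{p,\infty}:\mathbb{N}\to\mathbb{Z}_p\setminus p\mathbb{Z}_p$ such that $a_n=f_{p,\infty}(n)\,g_{p,\infty}(n)$ for every $n\in\mathbb{N}$.
   Context: $\mathbb{N}=\{0,1,2,\dots\}$. For $x,y\in\mathbb{Q}_p$, $x\equiv y\pmod{p^k}$ means $v_p(x-y)\ge k$. A pseudo-polynomial decomposition of $(a_n)_{n\in\mathbb{N}}\subset\mathbb{Z}_p$ modulo $p$ (on $\mathbb{N}$) is a sequence of pairs $(f_{p,k},g_{p,k})_{k\ge 2}$ such that: $f_{p,k}\in\mathbb{Z}_p[X]$ and $g_{p,k}:\mathbb{N}\to\mathbb{Z}_p\setminus p\mathbb{Z}_p$ for $k\ge2$; $a_n\equiv f_{p,k}(n)g_{p,k}(n)\pmod{p^k}$ for all $n\in\mathbb{N}$, $k\ge2$; and $f'_{p,k}(n)\equiv f'_{p,2}(n)\pmod p$ for all $k\ge 2$ and $n\in\mathbb{N}$, where $f'$ is the derivative of the polynomial $f$. *)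

theory Defs
  imports
    "HOL-Analysis.Analysis"
    "HOL-Computational_Algebra.Computational_Algebra"
    "HOL-Library.Extended_Nat"
    "Berlekamp_Zassenhaus.Finite_Field"
begin

section \<open>The ring of p-adic integers\<close>

text \<open>
  The prime p is the cardinality of the type parameter, so that quantifying over a type of class
  \<open>prime_card\<close> is quantifying over all primes.  The p-adic integers are the inverse limit of the
  rings of residues modulo p, p^2, p^3, ...; an element is the sequence of its least nonnegative
  residues.
\<close>

typedef (overloaded) 'p padic_int =
  "{x :: nat \<Rightarrow> int. \<forall>k. x k \<in> {0..<int CARD('p::prime_card) ^ k} \<and>
                         x (Suc k) mod int CARD('p) ^ k = x k}"
  morphisms residue Abs_padic_int
  by (rule exI[of _ "\<lambda>_. 0"]) simp

setup_lifting type_definition_padic_int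

lemma prime_power_card_pos: "0 < int CARD('p::prime_card) ^ k"
  by simp

lemma mod_mod_Suc_card:
  "(a mod int CARD('p::prime_card) ^ Suc k) mod int CARD('p) ^ k = a mod int CARD('p) ^ k"
  by (simp add: mod_mod_cancel)

lemma residue_bounds: "0 \<le> residue x k" "residue (x :: 'p::prime_card padic_int) k < int CARD('p) ^ k"
  using residue[of x] by auto

lemma residue_Suc_mod: "residue (x :: 'p::prime_card padic_int) (Suc k) mod int CARD('p) ^ k = residue x k"
  using residue[of x] by auto

lemma padic_int_eqI: "(\<And>k. residue x k = residue y k) \<Longrightarrow> x = y"
  by (simp add: residue_inject[symmetric] fun_eq_iff)

lemma residue_mod_self [simp]:
  "residue (x :: 'p::prime_card padic_int) k mod int CARD('p) ^ k = residue x k"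
  by (simp add: residue_bounds)

lemma residue_add_mod:
  "residue (x :: 'p::prime_card padic_int) (k + j) mod int CARD('p) ^ k = residue x k"
proof (induction j)
  case (Suc j)
  have "residue x (k + Suc j) mod int CARD('p) ^ k
      = (residue x (Suc (k + j)) mod int CARD('p) ^ (k + j)) mod int CARD('p) ^ k"
    by (simp add: mod_mod_cancel power_add)
  also have "\<dots> = residue x k"
    by (simp only: residue_Suc_mod Suc)
  finally show ?case .
qed simp

instantiation padic_int :: (prime_card) comm_ring_1
begin

lift_definition zero_padic_int :: "'a padic_int" is "\<lambda>_. 0"
  by simp

lift_definition one_padic_int :: "'a padic_int" is "\<lambda>k. 1 mod int CARD('a) ^ k"
  by (auto simp: mod_mod_Suc_card simp del: power_Suc)

lift_definition plus_padic_int :: "'a padic_int \<Rightarrow> 'a padic_int \<Rightarrow> 'a padic_int" is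
  "\<lambda>x y k. (x k + y k) mod int CARD('a) ^ k"
by (auto simp: mod_mod_Suc_card simp del: power_Suc) (metis mod_add_eq)

lift_definition times_padic_int :: "'a padic_int \<Rightarrow> 'a padic_int \<Rightarrow> 'a padic_int" is
  "\<lambda>x y k. (x k * y k) mod int CARD('a) ^ k"
by (auto simp: mod_mod_Suc_card simp del: power_Suc) (metis mod_mult_eq)

lift_definition uminus_padic_int :: "'a padic_int \<Rightarrow> 'a padic_int" is
  "\<lambda>x k. (- x k) mod int CARD('a) ^ k"
by (auto simp: mod_mod_Suc_card simp del: power_Suc) (metis mod_minus_eq)

lift_definition minus_padic_int :: "'a padic_int \<Rightarrow> 'a padic_int \<Rightarrow> 'a padic_int" is
  "\<lambda>x y k. (x k - y k) mod int CARD('a) ^ k"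
by (auto simp: mod_mod_Suc_card simp del: power_Suc) (metis mod_diff_eq)

instance
proof
  fix a b c :: "'a padic_int"
  show "a * b * c = a * (b * c)"
    by (rule padic_int_eqI) (simp add: times_padic_int.rep_eq mod_simps mult.assoc)
  show "a * b = b * a"
    by (rule padic_int_eqI) (simp add: times_padic_int.rep_eq mult.commute)
  show "1 * a = a"
    by (rule padic_int_eqI) (simp add: times_padic_int.rep_eq one_padic_int.rep_eq mod_simps)
  show "a + b + c = a + (b + c)"
    by (rule padic_int_eqI) (simp add: plus_padic_int.rep_eq mod_simps add.assoc)
  show "a + b = b + a"
    by (rule padic_int_eqI) (simp add: plus_padic_int.rep_eq add.commute)
  show "0 + a = a"
    by (rule padic_int_eqI) (simp add: plus_padic_int.rep_eq zero_padic_int.rep_eq)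
  show "- a + a = 0"
    by (rule padic_int_eqI)
      (simp add: plus_padic_int.rep_eq uminus_padic_int.rep_eq zero_padic_int.rep_eq mod_simps)
  show "a - b = a + - b"
    by (rule padic_int_eqI)
      (simp add: plus_padic_int.rep_eq uminus_padic_int.rep_eq minus_padic_int.rep_eq mod_simps)
  show "(a + b) * c = a * c + b * c"
    by (rule padic_int_eqI)
      (simp add: plus_padic_int.rep_eq times_padic_int.rep_eq mod_simps distrib_right)
  have "1 < int CARD('a)"
    using prime_gt_1_nat[OF prime_card[where 'a='a]] by simp
  then have "residue (0 :: 'a padic_int) 1 \<noteq> residue 1 1"
    by (simp add: zero_padic_int.rep_eq one_padic_int.rep_eq)
  then show "(0 :: 'a padic_int) \<noteq> 1"
    by auto
qed

end

lemma prime_power_dvd_multD: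
  fixes p a b :: int
  assumes "prime p" "p ^ (k + j) dvd a * b"
  shows "p ^ k dvd a \<or> p ^ j dvd b"
proof (cases "a = 0 \<or> b = 0")
  case False
  then have ab: "a \<noteq> 0" "b \<noteq> 0" by auto
  have nu: "\<not> is_unit p"
    using assms(1) by auto
  have "k + j \<le> multiplicity p (a * b)"
    using assms ab nu by (simp add: power_dvd_iff_le_multiplicity)
  also have "\<dots> = multiplicity p a + multiplicity p b"
    using assms(1) ab by (intro prime_elem_multiplicity_mult_distrib) auto
  finally have "k \<le> multiplicity p a \<or> j \<le> multiplicity p b"
    by linarith
  then show ?thesis
    using multiplicity_dvd' by blast
qed auto

instance padic_int :: (prime_card) idom
proof
  fix a b :: "'a padic_int"
  assume "a \<noteq> 0" "b \<noteq> 0"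
  then obtain k j where kj: "residue a k \<noteq> 0" "residue b j \<noteq> 0"
    by (metis padic_int_eqI zero_padic_int.rep_eq)
  have p: "prime (int CARD('a))"
    using prime_card by simp
  have "\<not> int CARD('a) ^ k dvd residue a (k + j)"
    using kj(1) residue_add_mod[of a k j] by (simp add: dvd_eq_mod_eq_0)
  moreover have "\<not> int CARD('a) ^ j dvd residue b (k + j)"
    using kj(2) residue_add_mod[of b j k] by (simp add: dvd_eq_mod_eq_0 add.commute)
  ultimately have "\<not> int CARD('a) ^ (k + j) dvd residue a (k + j) * residue b (k + j)"
    using prime_power_dvd_multD[OF p] by blast
  then have "residue (a * b) (k + j) \<noteq> 0"
    by (simp add: times_padic_int.rep_eq dvd_eq_mod_eq_0)
  then show "a * b \<noteq> 0"
    by (auto simp: zero_padic_int.rep_eq)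
qed

lemma residue_of_nat:
  "residue (of_nat n :: 'p::prime_card padic_int) k = int n mod int CARD('p) ^ k"
  by (induction n)
    (simp_all add: zero_padic_int.rep_eq one_padic_int.rep_eq plus_padic_int.rep_eq mod_simps)

text \<open>Divisibility by the k-th power of p is the vanishing of the k-th residue.\<close>

lemma power_card_dvd_iff_residue:
  fixes x :: "'p::prime_card padic_int"
  shows "of_nat CARD('p) ^ k dvd x \<longleftrightarrow> residue x k = 0"
proof
  assume "of_nat CARD('p) ^ k dvd x"
  then obtain y where "x = of_nat (CARD('p) ^ k) * y"
    by (auto simp: dvd_def)
  then show "residue x k = 0"
    by (simp only: times_padic_int.rep_eq residue_of_nat) simp
next
  let ?p = "int CARD('p)"
  assume x0: "residue x k = 0"
  define y where "y j = residue x (k + j) div ?p ^ k" for j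
  have xy: "residue x (k + j) = ?p ^ k * y j" for j
  proof -
    have "?p ^ k dvd residue x (k + j)"
      using residue_add_mod[of x k j] x0 by (simp add: dvd_eq_mod_eq_0)
    then show ?thesis by (simp add: y_def)
  qed
  have y: "y j \<in> {0..<?p ^ j} \<and> y (Suc j) mod ?p ^ j = y j" for j
  proof -
    have pos: "0 < ?p ^ k"
      by simp
    have "0 \<le> y j"
      using residue_bounds(1)[of x "k + j"] pos unfolding y_def by (simp only: pos_imp_zdiv_nonneg_iff)
    moreover have "?p ^ k * y j < ?p ^ k * ?p ^ j"
      using residue_bounds(2)[of x "k + j"] unfolding xy power_add .
    then have "y j < ?p ^ j"
      using pos by (rule mult_left_less_imp_less[OF _ less_imp_le])
    moreover have "?p ^ k * (y (Suc j) mod ?p ^ j) = ?p ^ k * y j"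
      using residue_Suc_mod[of x "k + j"] unfolding add_Suc_right[symmetric] xy power_add mult_mod_right .
    then have "y (Suc j) mod ?p ^ j = y j"
      using pos unfolding mult_cancel_left by linarith
    ultimately show ?thesis by simp
  qed
  have "residue (Abs_padic_int y :: 'p padic_int) = y"
    using y by (intro Abs_padic_int_inverse) simp
  moreover have "residue x j = ?p ^ k * y j mod ?p ^ j" for j
    using residue_add_mod[of x j k] xy[of j] by (simp add: add.commute)
  moreover have "residue (of_nat (CARD('p) ^ k) :: 'p padic_int) j = ?p ^ k mod ?p ^ j" for j
    unfolding residue_of_nat by simp
  ultimately have "x = of_nat (CARD('p) ^ k) * Abs_padic_int y"
    by (intro padic_int_eqI) (simp only: times_padic_int.rep_eq mod_mult_left_eq)
  then show "of_nat CARD('p) ^ k dvd x"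
    by simp
qed


section \<open>Valuation, congruence and metric\<close>

definition padic_val :: "'p::prime_card padic_int \<Rightarrow> enat" where
  "padic_val x = (SUP k \<in> {k. of_nat CARD('p) ^ k dvd x}. enat k)"

definition padic_cong :: "'p::prime_card padic_int \<Rightarrow> 'p padic_int \<Rightarrow> nat \<Rightarrow> bool" where
  "padic_cong x y k \<longleftrightarrow> enat k \<le> padic_val (x - y)"

definition padic_norm :: "'p::prime_card padic_int \<Rightarrow> real" where
  "padic_norm x = (case padic_val x of enat k \<Rightarrow> 1 / real CARD('p) ^ k | \<infinity> \<Rightarrow> 0)"

lemma le_padic_val_iff:
  fixes x :: "'p::prime_card padic_int"
  shows "enat k \<le> padic_val x \<longleftrightarrow> of_nat CARD('p) ^ k dvd x"
proof
  assume "of_nat CARD('p) ^ k dvd x"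
  then show "enat k \<le> padic_val x"
    unfolding padic_val_def by (intro SUP_upper) simp
next
  assume le: "enat k \<le> padic_val x"
  show "of_nat CARD('p) ^ k dvd x"
  proof (rule ccontr)
    assume ndvd: "\<not> of_nat CARD('p) ^ k dvd x"
    then have k: "k > 0"
      by (cases k) auto
    have "j \<le> k - 1" if "of_nat CARD('p) ^ j dvd x" for j
    proof -
      have "\<not> k \<le> j"
        using ndvd dvd_trans[OF le_imp_power_dvd that] by blast
      then show ?thesis by linarith
    qed
    then have "padic_val x \<le> enat (k - 1)"
      unfolding padic_val_def by (intro SUP_least) simp
    with le have "enat k \<le> enat (k - 1)"
      by (rule order_trans)
    with k show False
      by simp
  qed
qed

lemma padic_val_eq_infinity_iff: "padic_val x = \<infinity> \<longleftrightarrow> x = 0"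
proof
  assume inf: "padic_val x = \<infinity>"
  have "residue x k = 0" for k
  proof -
    have "enat k \<le> padic_val x"
      by (simp add: inf)
    then show ?thesis
      unfolding le_padic_val_iff power_card_dvd_iff_residue .
  qed
  then show "x = 0"
    by (intro padic_int_eqI) (simp add: zero_padic_int.rep_eq)
next
  assume x: "x = 0"
  show "padic_val x = \<infinity>"
  proof (cases "padic_val x")
    case (enat n)
    have "enat (Suc n) \<le> padic_val x"
      unfolding le_padic_val_iff x by (rule dvd_0_right)
    with enat show ?thesis by simp
  qed
qed

lemma padic_val_minus: "padic_val (- x) = padic_val x"
  by (simp add: padic_val_def)

lemma padic_val_add: "min (padic_val x) (padic_val y) \<le> padic_val (x + y)"
proof (rule ccontr)
  assume "\<not> ?thesis"
  then have "padic_val (x + y) < min (padic_val x) (padic_val y)"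
    by (simp only: not_le)
  then obtain k where k: "padic_val (x + y) = enat k" "enat k < min (padic_val x) (padic_val y)"
    by (cases "padic_val (x + y)") simp_all
  then have "enat (Suc k) \<le> padic_val x" "enat (Suc k) \<le> padic_val y"
    by (simp_all add: Suc_ile_eq)
  then have "enat (Suc k) \<le> padic_val (x + y)"
    unfolding le_padic_val_iff by (rule dvd_add)
  with k show False by simp
qed

lemma card_prime_gt_1: "1 < real CARD('p::prime_card)"
  using prime_gt_1_nat[OF prime_card[where 'a='p]] by simp

lemma padic_norm_nonneg: "0 \<le> padic_norm x"
  by (simp add: padic_norm_def split: enat.splits)

lemma padic_norm_eq_0_iff: "padic_norm x = 0 \<longleftrightarrow> x = 0"
proof -
  have "padic_norm x = 0 \<longleftrightarrow> padic_val x = \<infinity>"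
    using card_prime_gt_1[where 'p='a] by (cases "padic_val x") (simp_all add: padic_norm_def)
  then show ?thesis
    by (simp only: padic_val_eq_infinity_iff)
qed

lemma padic_norm_mono:
  fixes x y :: "'p::prime_card padic_int"
  assumes le: "padic_val y \<le> padic_val x"
  shows "padic_norm x \<le> padic_norm y"
proof (cases "padic_val x")
  case (enat k)
  then obtain j where j: "padic_val y = enat j" "j \<le> k"
    using le by (cases "padic_val y") simp_all
  have "real CARD('p) ^ j \<le> real CARD('p) ^ k"
    using j(2) card_prime_gt_1[where 'p='p] by (intro power_increasing) simp_all
  moreover have "0 < real CARD('p) ^ j"
    using card_prime_gt_1[where 'p='p] by (intro zero_less_power) linarith
  ultimately have "1 / real CARD('p) ^ k \<le> 1 / real CARD('p) ^ j"
    by (intro frac_le) simp_all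
  then show ?thesis
    unfolding padic_norm_def enat j(1) by simp
next
  case infinity
  then have "padic_norm x = 0"
    by (simp add: padic_norm_def)
  then show ?thesis
    using padic_norm_nonneg[of y] by linarith
qed

lemma padic_norm_add: "padic_norm (x + y) \<le> max (padic_norm x) (padic_norm y)"
proof (cases "padic_val x \<le> padic_val y")
  case True
  then have "padic_val x \<le> padic_val (x + y)"
    using padic_val_add[of x y] by (simp only: min_absorb1)
  then show ?thesis
    by (intro max.coboundedI1 padic_norm_mono)
next
  case False
  then have "padic_val y \<le> padic_val (x + y)"
    using padic_val_add[of x y] by (simp only: min_def if_False)
  then show ?thesis
    by (intro max.coboundedI2 padic_norm_mono)
qed

instantiation padic_int :: (prime_card) metric_space
begin

definition dist_padic_int :: "'a padic_int \<Rightarrow> 'a padic_int \<Rightarrow> real" where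
  "dist_padic_int x y = padic_norm (x - y)"

definition uniformity_padic_int :: "('a padic_int \<times> 'a padic_int) filter" where
  "uniformity_padic_int = (INF e\<in>{0<..}. principal {(x, y). dist x y < e})"

definition open_padic_int :: "'a padic_int set \<Rightarrow> bool" where
  "open_padic_int U \<longleftrightarrow> (\<forall>x\<in>U. eventually (\<lambda>(x', y). x' = x \<longrightarrow> y \<in> U) uniformity)"

instance
proof
  fix x y z :: "'a padic_int" and U :: "'a padic_int set"
  show "uniformity = (INF e\<in>{0<..}. principal {(x, y :: 'a padic_int). dist x y < e})"
    by (rule uniformity_padic_int_def)
  show "open U \<longleftrightarrow> (\<forall>x\<in>U. eventually (\<lambda>(x', y). x' = x \<longrightarrow> y \<in> U) uniformity)"
    by (rule open_padic_int_def)
  show "dist x y = 0 \<longleftrightarrow> x = y"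
    by (simp add: dist_padic_int_def padic_norm_eq_0_iff)
  have "padic_norm (z - y) = padic_norm (y - z)"
    using padic_val_minus[of "y - z"] by (simp add: padic_norm_def)
  then show "dist x y \<le> dist x z + dist y z"
    using padic_norm_add[of "x - z" "z - y"] padic_norm_nonneg[of "x - z"] padic_norm_nonneg[of "y - z"]
    unfolding dist_padic_int_def by (simp add: max_def split: if_splits)
qed

end


section \<open>Pseudo-polynomial decompositions\<close>

text \<open>The entries of the sequences f and g with index below 2 play no role.\<close>

definition pseudo_polynomial_decomposition ::
  "(nat \<Rightarrow> 'p::prime_card padic_int) \<Rightarrow> (nat \<Rightarrow> 'p padic_int poly) \<Rightarrow>
   (nat \<Rightarrow> nat \<Rightarrow> 'p padic_int) \<Rightarrow> bool" where
  "pseudo_polynomial_decomposition a f g \<longleftrightarrow>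
     (\<forall>k\<ge>2. \<forall>n. \<not> of_nat CARD('p) dvd g k n) \<and>
     (\<forall>k\<ge>2. \<forall>n. padic_cong (a n) (poly (f k) (of_nat n) * g k n) k) \<and>
     (\<forall>k\<ge>2. \<forall>n. padic_cong (poly (pderiv (f k)) (of_nat n)) (poly (pderiv (f 2)) (of_nat n)) 1)"

end

theory Submission
  imports Defs "HOL-Library.Diagonal_Subsequence"
begin

text \<open>
  Polynomials over the p-adic integers are 1-Lipschitz, and residues modulo a fixed power of p take
  finitely many values.  So, as in Arzela-Ascoli, a diagonal argument yields a subsequence along
  which the residues of all \<open>f\<^sub>k(n)\<close> and all \<open>g\<^sub>k(n)\<close> are eventually constant: the \<open>f\<^sub>k\<close> then
  converge uniformly, the \<open>g\<^sub>k\<close> pointwise, and the congruences for \<open>a\<^sub>n\<close> become equalities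
  in the limit.
  Reducing the coefficients of \<open>f\<^sub>k\<close> modulo growing powers of p gives integer polynomials with the
  same limit.
\<close>

text \<open>Since the index type is countable, the coordinates can be treated one at a time: the
  pigeonhole principle refines the current subsequence so that one more coordinate becomes constant,
  and the diagonal is eventually a subsequence of every refinement.\<close>

lemma diagonal_eventually_constant:
  fixes F :: "nat \<Rightarrow> 'i::countable \<Rightarrow> 'b"
  assumes fin: "\<And>i. finite (range (\<lambda>k. F k i))"
  obtains r L where "strict_mono (r :: nat \<Rightarrow> nat)"
    "\<And>i. \<forall>\<^sub>F k in sequentially. F (r k) i = L i"
proof -
  define P where "P j s \<longleftrightarrow> (\<exists>c. \<forall>k. F (s k) (from_nat j) = c)" for j and s :: "nat \<Rightarrow> nat"
  interpret subseqs P
  proof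
    fix j and s :: "nat \<Rightarrow> nat"
    have "finite (range (\<lambda>k. F (s k) (from_nat j)))"
      by (rule finite_subset[OF _ fin[of "from_nat j"]]) auto
    from pigeonhole_infinite[OF infinite_UNIV_nat this]
    obtain k0 where inf: "infinite {k. F (s k) (from_nat j) = F (s k0) (from_nat j)}"
      by auto
    let ?A = "{k. F (s k) (from_nat j) = F (s k0) (from_nat j)}"
    \<comment> \<open>The infinite fibre \<open>?A\<close>, listed in increasing order, is the
      refinement that freezes coordinate \<open>j\<close>.\<close>
    have "P j (s \<circ> enumerate ?A)"
      using enumerate_in_set[OF inf] by (auto simp: P_def)
    then show "\<exists>r'. strict_mono r' \<and> P j (s \<circ> r')"
      using strict_mono_enumerate[OF inf] by blast
  qed
  have "\<exists>c. \<forall>\<^sub>F k in sequentially. F (diagseq k) i = c" for i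
  proof -
    \<comment> \<open>The shift discards the terms chosen before coordinate \<open>i\<close> was
      frozen; constancy then survives because it passes to subsequences.\<close>
    have "P (to_nat i) (diagseq \<circ> ((+) (Suc (to_nat i))))"
      by (rule diagseq_holds) (auto simp: P_def)
    then obtain c where c: "F (diagseq (Suc (to_nat i) + k)) i = c" for k
      by (auto simp: P_def)
    have "F (diagseq k) i = c" if "k \<ge> Suc (to_nat i)" for k
      using c[of "k - Suc (to_nat i)"] that by simp
    then show ?thesis
      unfolding eventually_sequentially by blast
  qed
  then obtain L where "\<And>i. \<forall>\<^sub>F k in sequentially. F (diagseq k) i = L i"
    by metis
  with subseq_diagseq show ?thesis
    by (rule that)
qed

lemma residue_le_mod:
  fixes x :: "'p::prime_card padic_int"
  assumes "m \<le> k"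
  shows "residue x k mod int CARD('p) ^ m = residue x m"
  using residue_add_mod[of x m "k - m"] assms by simp

lemma residue_of_int_residue:
  fixes x :: "'p::prime_card padic_int"
  shows "residue (of_int (residue x m) :: 'p padic_int) m = residue x m"
proof -
  have "(of_int (residue x m) :: 'p padic_int) = of_nat (nat (residue x m))"
    by (simp add: residue_bounds)
  then show ?thesis
    by (simp only: residue_of_nat) (simp add: residue_bounds)
qed

lemma residue_diff_eq_0_iff:
  fixes x y :: "'p::prime_card padic_int"
  shows "residue (x - y) m = 0 \<longleftrightarrow> residue x m = residue y m"
  using mod_eq_dvd_iff[of "residue x m" "int CARD('p) ^ m" "residue y m"]
  by (simp add: minus_padic_int.rep_eq dvd_eq_mod_eq_0)

text \<open>Moves the valuation conditions of a decomposition into the finite rings of residues,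
  where the pigeonhole principle applies.\<close>

lemma padic_cong_iff_residue:
  fixes x y :: "'p::prime_card padic_int"
  shows "padic_cong x y m \<longleftrightarrow> residue x m = residue y m"
  unfolding padic_cong_def le_padic_val_iff power_card_dvd_iff_residue residue_diff_eq_0_iff ..

lemma card_dvd_iff_residue:
  fixes x :: "'p::prime_card padic_int"
  shows "of_nat CARD('p) dvd x \<longleftrightarrow> residue x 1 = 0"
  using power_card_dvd_iff_residue[of 1 x] by simp

text \<open>The norm takes only the value 0 and inverse powers of p, so the closed ball of radius
  \<open>1 / p ^ m\<close> is exactly a residue class modulo \<open>p ^ m\<close>.\<close>

lemma dist_le_iff_residue_eq:
  fixes x y :: "'p::prime_card padic_int"
  shows "dist x y \<le> 1 / real CARD('p) ^ m \<longleftrightarrow> residue x m = residue y m"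
proof -
  have gt: "1 < real CARD('p)"
    by (rule card_prime_gt_1)
  have "dist x y \<le> 1 / real CARD('p) ^ m \<longleftrightarrow> enat m \<le> padic_val (x - y)"
  proof (cases "padic_val (x - y)")
    case (enat j)
    have "1 / real CARD('p) ^ j \<le> 1 / real CARD('p) ^ m \<longleftrightarrow> real CARD('p) ^ m \<le> real CARD('p) ^ j"
      using gt by (simp add: field_simps)
    also have "\<dots> \<longleftrightarrow> m \<le> j"
      using gt by (rule power_increasing_iff)
    finally show ?thesis
      by (simp add: dist_padic_int_def padic_norm_def enat)
  qed (use gt in \<open>simp add: dist_padic_int_def padic_norm_def\<close>)
  then show ?thesis
    using padic_cong_iff_residue[of x y m] by (simp add: padic_cong_def)
qed

lemma ex_inverse_power_card_less:
  assumes "0 < e"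
  obtains m where "1 / real CARD('p::prime_card) ^ m < e"
proof -
  have "\<bar>1 / real CARD('p)\<bar> < 1"
    using card_prime_gt_1[where 'p='p] by simp
  then obtain m where "(1 / real CARD('p)) ^ m < e"
    using real_arch_pow_inv[OF assms, of "1 / real CARD('p)"] by auto
  then show ?thesis
    by (intro that[of m]) (simp add: power_divide)
qed

text \<open>Reduction modulo \<open>p ^ m\<close> is a ring homomorphism, so it commutes with
  evaluation. This is the 1-Lipschitz bound, with a constant independent of
  \<open>f\<close>.\<close>

lemma residue_poly_cong:
  fixes x y :: "'p::prime_card padic_int"
  assumes "residue x m = residue y m"
  shows "residue (poly f x) m = residue (poly f y) m"
  by (induction f) (simp_all add: plus_padic_int.rep_eq times_padic_int.rep_eq assms)

text \<open>The same homomorphism argument, applied to the coefficients: one integer polynomial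
  approximates \<open>f\<close> to within \<open>1 / p ^ m\<close> at all points
  simultaneously.\<close>

lemma residue_poly_reduce_coeffs:
  fixes x :: "'p::prime_card padic_int"
  shows "residue (poly (map_poly of_int (map_poly (\<lambda>c. residue c m) f)) x) m = residue (poly f x) m"
  by (induction f)
    (simp_all add: Polynomial.map_poly_pCons zero_padic_int.rep_eq plus_padic_int.rep_eq times_padic_int.rep_eq
      residue_of_int_residue)

lemma finite_range_residue:
  fixes x :: "'k \<Rightarrow> 'p::prime_card padic_int"
  shows "finite (range (\<lambda>k. residue (x k) m))"
  by (rule finite_subset[of _ "{0..<int CARD('p) ^ m}"]) (auto simp: residue_bounds)

text \<open>Coherence of \<open>L\<close> between levels \<open>m\<close> and \<open>Suc m\<close>
  is inherited from a single term \<open>x k\<close> at which both residues have stabilised.\<close>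

lemma ex_padic_int_eventual_residues:
  fixes x :: "nat \<Rightarrow> 'p::prime_card padic_int"
  assumes ev: "\<And>m. \<forall>\<^sub>F k in sequentially. residue (x k) m = L m"
  obtains y where "residue (y :: 'p padic_int) = L"
proof -
  have "L m \<in> {0..<int CARD('p) ^ m} \<and> L (Suc m) mod int CARD('p) ^ m = L m" for m
  proof -
    have "\<forall>\<^sub>F k in sequentially. residue (x k) m = L m \<and> residue (x k) (Suc m) = L (Suc m)"
      by (intro eventually_conj ev)
    then obtain k where "residue (x k) m = L m" "residue (x k) (Suc m) = L (Suc m)"
      unfolding eventually_sequentially by blast
    then show ?thesis
      using residue_bounds[of "x k" m] residue_Suc_mod[of "x k" m] by auto
  qed
  then show ?thesis
    by (intro that[of "Abs_padic_int L"] Abs_padic_int_inverse) simp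
qed

theorem mainTheorem2:
  fixes a :: "nat \<Rightarrow> 'p::prime_card padic_int"
  assumes "\<exists>f g. pseudo_polynomial_decomposition a f g"
  shows "\<exists>(f_inf :: 'p padic_int \<Rightarrow> 'p padic_int) (g_inf :: nat \<Rightarrow> 'p padic_int).
           continuous_on UNIV f_inf \<and>
           (\<exists>F :: nat \<Rightarrow> int poly.
              uniform_limit UNIV (\<lambda>m x. poly (map_poly of_int (F m)) x) f_inf sequentially) \<and>
           (\<forall>n. \<not> of_nat CARD('p) dvd g_inf n) \<and>
           (\<forall>n. a n = f_inf (of_nat n) * g_inf n)"
proof -
  obtain f g where "pseudo_polynomial_decomposition a f g"
    using assms by blast
  then have unit: "residue (g k n) 1 \<noteq> 0"
    and cong: "residue (a n) k = residue (poly (f k) (of_nat n) * g k n) k" if "k \<ge> 2" for k n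
    using that by (simp_all add: pseudo_polynomial_decomposition_def padic_cong_iff_residue
        card_dvd_iff_residue)
  \<comment> \<open>Pairing the residues of \<open>f\<close> and \<open>g\<close> lets one
    extraction stabilise both along the same subsequence.\<close>
  define \<Phi> where "\<Phi> k = (\<lambda>(n, m). (residue (poly (f k) (of_nat n)) m, residue (g k n) m))" for k
  have "finite (range (\<lambda>k. \<Phi> k i))" for i
  proof (cases i)
    case (Pair n m)
    have "range (\<lambda>k. \<Phi> k i)
        \<subseteq> range (\<lambda>k. residue (poly (f k) (of_nat n)) m) \<times> range (\<lambda>k. residue (g k n) m)"
      by (auto simp: \<Phi>_def Pair)
    then show ?thesis
      by (rule finite_subset) (intro finite_cartesian_product finite_range_residue)
  qed
  then obtain r :: "nat \<Rightarrow> nat" and L where r: "strict_mono r"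
    and L: "\<And>i. \<forall>\<^sub>F k in sequentially. \<Phi> (r k) i = L i"
    using diagonal_eventually_constant[of \<Phi>] by blast
  have Lf: "\<forall>\<^sub>F k in sequentially. residue (poly (f (r k)) (of_nat n)) m = fst (L (n, m))"
    and Lg: "\<forall>\<^sub>F k in sequentially. residue (g (r k) n) m = snd (L (n, m))" for n m
    using L[of "(n, m)"] by (auto simp: \<Phi>_def prod_eq_iff elim!: eventually_mono)

  \<comment> \<open>Uniformity in \<open>x\<close>: every \<open>x\<close> is congruent modulo
    \<open>p ^ m\<close> to one of the finitely many naturals below \<open>p ^ m\<close>, so
    finitely many eventual statements suffice.\<close>
  have ev: "\<forall>\<^sub>F k in sequentially. \<forall>x. residue (poly (f (r k)) x) m = fst (L (nat (residue x m), m))"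
    for m
  proof -
    have "\<forall>\<^sub>F k in sequentially. \<forall>n\<in>{..<CARD('p) ^ m}.
        residue (poly (f (r k)) (of_nat n)) m = fst (L (n, m))"
      using Lf by (simp add: eventually_ball_finite_distrib)
    then show ?thesis
    proof (rule eventually_mono, intro allI)
      fix k and x :: "'p padic_int"
      assume *: "\<forall>n\<in>{..<CARD('p) ^ m}. residue (poly (f (r k)) (of_nat n)) m = fst (L (n, m))"
      have "nat (residue x m) < CARD('p) ^ m"
        using residue_bounds[of x m] by (simp add: nat_less_iff)
      with * have "residue (poly (f (r k)) (of_nat (nat (residue x m)))) m
          = fst (L (nat (residue x m), m))"
        by blast
      moreover have "residue (of_nat (nat (residue x m)) :: 'p padic_int) m = residue x m"
        by (simp add: residue_bounds residue_of_int_residue)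
      ultimately show "residue (poly (f (r k)) x) m = fst (L (nat (residue x m), m))"
        using residue_poly_cong by metis
    qed
  qed
  have "\<exists>y :: 'p padic_int. residue y = (\<lambda>m. fst (L (nat (residue x m), m)))" for x :: "'p padic_int"
  proof -
    have "\<forall>\<^sub>F k in sequentially. residue (poly (f (r k)) x) m = fst (L (nat (residue x m), m))" for m
      using ev[of m] by (rule eventually_mono) blast
    then show ?thesis
      by (rule ex_padic_int_eventual_residues) blast
  qed
  then obtain f_inf :: "'p padic_int \<Rightarrow> 'p padic_int"
    where f_inf: "\<And>x. residue (f_inf x) = (\<lambda>m. fst (L (nat (residue x m), m)))"
    by metis
  have ev_f: "\<forall>\<^sub>F k in sequentially. \<forall>x. residue (poly (f (r k)) x) m = residue (f_inf x) m" for m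
    using ev by (simp add: f_inf)
  have "\<exists>y :: 'p padic_int. residue y = (\<lambda>m. snd (L (n, m)))" for n
    using Lg by (rule ex_padic_int_eventual_residues) blast
  then obtain g_inf :: "nat \<Rightarrow> 'p padic_int" where g_inf: "\<And>n. residue (g_inf n) = (\<lambda>m. snd (L (n, m)))"
    by metis
  have ev_g: "\<forall>\<^sub>F k in sequentially. residue (g (r k) n) m = residue (g_inf n) m" for n m
    using Lg by (simp add: g_inf)
  \<comment> \<open>The precision \<open>r k\<close> of the congruences tends to infinity; with
    \<open>m = 2\<close> this also brings the index into the range where \<open>unit\<close> and
    \<open>cong\<close> hold.\<close>
  have ev_r: "\<forall>\<^sub>F k in sequentially. m \<le> r k" for m
    using filterlim_subseq[OF r] by (simp add: filterlim_at_top)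

  have "continuous_on UNIV f_inf"
    unfolding continuous_on_iff
  proof (intro ballI allI impI)
    fix x :: "'p padic_int" and e :: real
    assume "0 < e"
    then obtain m where m: "1 / real CARD('p) ^ m < e"
      by (rule ex_inverse_power_card_less)
    have "dist (f_inf y) (f_inf x) < e" if "dist y x < 1 / real CARD('p) ^ m" for y
    proof -
      \<comment> \<open>The residue of \<open>f_inf x\<close> at level \<open>m\<close> depends only
        on that of \<open>x\<close>, so \<open>1 / p ^ m\<close> serves as delta.\<close>
      have "residue y m = residue x m"
        using that by (simp flip: dist_le_iff_residue_eq)
      then have "residue (f_inf y) m = residue (f_inf x) m"
        by (simp add: f_inf)
      then show ?thesis
        using m unfolding dist_le_iff_residue_eq[symmetric] by linarith
    qed
    moreover have "0 < 1 / real CARD('p) ^ m"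
      using card_prime_gt_1[where 'p='p] by simp
    ultimately show "\<exists>d>0. \<forall>y\<in>UNIV. dist y x < d \<longrightarrow> dist (f_inf y) (f_inf x) < e"
      by blast
  qed
  \<comment> \<open>The modulus \<open>p ^ k\<close> grows with \<open>k\<close>, so this one
    sequence serves every precision \<open>m\<close>: once \<open>m \<le> k\<close>, agreement
    modulo \<open>p ^ k\<close> gives agreement modulo \<open>p ^ m\<close>.\<close>
  moreover define F where "F k = map_poly (\<lambda>c. residue c k) (f (r k))" for k
  have "uniform_limit UNIV (\<lambda>k x. poly (map_poly of_int (F k)) x) f_inf sequentially"
    unfolding uniform_limit_iff
  proof (intro allI impI)
    fix e :: real
    assume "0 < e"
    then obtain m where m: "1 / real CARD('p) ^ m < e"
      by (rule ex_inverse_power_card_less)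
    show "\<forall>\<^sub>F k in sequentially. \<forall>x\<in>UNIV. dist (poly (map_poly of_int (F k)) x) (f_inf x) < e"
      using ev_f[of m] eventually_ge_at_top[of m]
    proof (eventually_elim, intro ballI)
      fix k x
      assume k: "\<forall>x. residue (poly (f (r k)) x) m = residue (f_inf x) m" "m \<le> k"
      have "residue (poly (map_poly of_int (F k)) x) m = residue (poly (f (r k)) x) m"
        using residue_poly_reduce_coeffs[of k "f (r k)" x] residue_le_mod[OF k(2)]
        unfolding F_def by metis
      with k(1) have "residue (poly (map_poly of_int (F k)) x) m = residue (f_inf x) m"
        by simp
      then show "dist (poly (map_poly of_int (F k)) x) (f_inf x) < e"
        using m unfolding dist_le_iff_residue_eq[symmetric] by linarith
    qed
  qed
  moreover have "\<not> of_nat CARD('p) dvd g_inf n" for n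
  proof -
    \<comment> \<open>Being a unit is visible at level 1, where \<open>g_inf n\<close> eventually
      agrees with \<open>g (r k) n\<close>.\<close>
    have "\<forall>\<^sub>F k in sequentially. residue (g_inf n) 1 \<noteq> 0"
      using ev_g[of n 1] ev_r[of 2] by eventually_elim (metis unit)
    then show ?thesis
      by (simp add: card_dvd_iff_residue)
  qed
  moreover have "a n = f_inf (of_nat n) * g_inf n" for n
  proof (rule padic_int_eqI)
    fix m
    \<comment> \<open>The congruence modulo \<open>p ^ r k\<close> is lowered to level
      \<open>m\<close>, where both factors have reached their limits. The resulting equality is free
      of \<open>k\<close>, so holding eventually means holding outright.\<close>
    have "\<forall>\<^sub>F k in sequentially. residue (a n) m = residue (f_inf (of_nat n) * g_inf n) m"
      using ev_f[of m] ev_g[of n m] ev_r[of 2] ev_r[of m]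
    proof eventually_elim
      case (elim k)
      have "residue (a n) m = residue (poly (f (r k)) (of_nat n) * g (r k) n) m"
        using cong[OF elim(3)] residue_le_mod[OF elim(4)] by metis
      with elim(1,2) show ?case
        by (simp add: times_padic_int.rep_eq)
    qed
    then show "residue (a n) m = residue (f_inf (of_nat n) * g_inf n) m"
      by simp
  qed
  ultimately show ?thesis
    by blast
qed

end
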